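(* Let $\mathcal{H}$ be a complex Hilbert space, $A\in\mathbb{B}(\mathcal{H})$ a nonzero positive operator, $\lambda\in[0,1]$, and $T,S\in\mathbb{B}_{A^{1/2}}(\mathcal{H})$. The following statements are equivalent. (i) $\|T+S\|_{(A,\lambda)}=\|T\|_{(A,\lambda)}+\|S\|_{(A,\lambda)}$. (ii) There exists a sequence $\{x_n\}$ of $A$-unit vectors in $\mathcal{H}$ such that $$\lim_{n\to\infty}\Big(\lambda\langle Sx_n,Tx_n\rangle_A+(1-\lambda)\langle x_n,Tx_n\rangle_A\,\langle Sx_n,x_n\rangle_A\Big)=\|T\|_{(A,\lambda)}\,\|S\|_{(A,\lambda)}.$$
   Context: $\mathbb{B}(\mathcal{H})$ is the algebra of all bounded linear operators on the complex Hilbert space $(\mathcal{H},\langle\cdot,\cdot\rangle)$, with inner product linear in the first argument. The positive (semidefinite) operator $A\in\mathbb{B}(\mathcal{H})$ induces the positive semidefinite sesquilinear form $\langle x,y\rangle_A=\langle Ax,y\rangle$ and the seminorm $\|x\|_A=\sqrt{\langle x,x\rangle_A}$ on $\mathcal{H}$; $A$ is nonzero, so that vectors with $\|x\|_A=1$ exist. An $A$-unit vector is an $x\in\mathcal{H}$ with $\|x\|_A=1$. For a positive operator $B$, an operator $R\in\mathbb{B}(\mathcal{H})$ is a $B$-adjoint of $T\in\mathbb{B}(\mathcal{H})$ if $\langle BTx,y\rangle=\langle Bx,Ry\rangle$ for all $x,y\in\mathcal{H}$. $\mathbb{B}_{A^{1/2}}(\mathcal{H})$ is the set of all $T\in\mathbb{B}(\mathcal{H})$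 admitting an $A^{1/2}$-adjoint, where $A^{1/2}$ is the positive square root of $A$. For $T\in\mathbb{B}_{A^{1/2}}(\mathcal{H})$ one has $\sup\{\|Tx\|_A:\|x\|_A=1\}<+\infty$, and $$\|T\|_{(A,\lambda)}=\sup\Big\{\sqrt{\lambda\|Tx\|_A^2+(1-\lambda)|\langle Tx,x\rangle_A|^2}:\ x\in\mathcal{H},\ \|x\|_A=1\Big\}.$$ *)

theory Defs
  imports "HOL-Analysis.Analysis"
begin

text \<open>
  Complex Hilbert spaces. The inner product is linear in the \<^emph>\<open>first\<close> argument. The superclass
  \<^class>\<open>banach\<close> supplies the norm and completeness; the axioms below make its real scalar
  multiplication and its norm the ones belonging to the complex structure.
\<close>

class chilbert_space = banach +
  fixes scaleC :: "complex \<Rightarrow> 'a \<Rightarrow> 'a"  (infixr "*\<^sub>C" 75)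
    and cinner :: "'a \<Rightarrow> 'a \<Rightarrow> complex"
  assumes scaleC_add_right: "c *\<^sub>C (x + y) = c *\<^sub>C x + c *\<^sub>C y"
    and scaleC_add_left: "(c + d) *\<^sub>C x = c *\<^sub>C x + d *\<^sub>C x"
    and scaleC_scaleC: "c *\<^sub>C (d *\<^sub>C x) = (c * d) *\<^sub>C x"
    and scaleC_of_real: "complex_of_real r *\<^sub>C x = r *\<^sub>R x"
    and cinner_commute: "cinner x y = cnj (cinner y x)"
    and cinner_add_left: "cinner (x + y) z = cinner x z + cinner y z"
    and cinner_scaleC_left: "cinner (c *\<^sub>C x) y = c * cinner x y"
    and cinner_nonneg: "cinner x x \<in> \<real>\<^sub>\<ge>\<^sub>0"
    and cinner_eq_zero_iff: "cinner x x = 0 \<longleftrightarrow> x = 0"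
    and norm_eq_sqrt_cinner: "norm x = sqrt (Re (cinner x x))"

instantiation complex :: chilbert_space
begin

definition scaleC_complex :: "complex \<Rightarrow> complex \<Rightarrow> complex"
  where "scaleC_complex c z = c * z"

definition cinner_complex :: "complex \<Rightarrow> complex \<Rightarrow> complex"
  where "cinner_complex z w = z * cnj w"

instance
  by standard
    (auto simp: scaleC_complex_def cinner_complex_def algebra_simps scaleR_conv_of_real
      complex_nonneg_Reals_iff cmod_def power2_eq_square)

end

text \<open>
  The type \<open>'h \<Rightarrow>\<^sub>L 'h\<close> consists of the bounded \<^emph>\<open>real\<close>-linear maps; the algebra of bounded
  operators on the complex space is its subset of complex-linear ones.
\<close>

definition bounded_ops :: "('h::chilbert_space \<Rightarrow>\<^sub>L 'h) set"
  where "bounded_ops = {T :: 'h \<Rightarrow>\<^sub>L 'h. \<forall>c x. T (c *\<^sub>C x) = c *\<^sub>C T x}"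

definition positive_op :: "('h::chilbert_space \<Rightarrow>\<^sub>L 'h) \<Rightarrow> bool"
  where "positive_op A \<longleftrightarrow> A \<in> bounded_ops \<and> (\<forall>x. cinner (A x) x \<in> \<real>\<^sub>\<ge>\<^sub>0)"

text \<open>For positive \<open>A\<close> there is exactly one such \<open>B\<close>, by the classical square root theorem.\<close>

definition sqrt_op :: "('h::chilbert_space \<Rightarrow>\<^sub>L 'h) \<Rightarrow> ('h \<Rightarrow>\<^sub>L 'h)"
  where "sqrt_op A = (THE B. positive_op B \<and> B o\<^sub>L B = A)"

definition is_adjoint_wrt ::
    "('h::chilbert_space \<Rightarrow>\<^sub>L 'h) \<Rightarrow> ('h \<Rightarrow>\<^sub>L 'h) \<Rightarrow> ('h \<Rightarrow>\<^sub>L 'h) \<Rightarrow> bool"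
  where "is_adjoint_wrt B T R \<longleftrightarrow>
    R \<in> bounded_ops \<and> (\<forall>x y. cinner (B (T x)) y = cinner (B x) (R y))"

definition sqrt_adjointable_ops :: "('h::chilbert_space \<Rightarrow>\<^sub>L 'h) \<Rightarrow> ('h \<Rightarrow>\<^sub>L 'h) set"
  where "sqrt_adjointable_ops A = {T \<in> bounded_ops. \<exists>R. is_adjoint_wrt (sqrt_op A) T R}"

definition cinner_wrt :: "('h::chilbert_space \<Rightarrow>\<^sub>L 'h) \<Rightarrow> 'h \<Rightarrow> 'h \<Rightarrow> complex"
  where "cinner_wrt A x y = cinner (A x) y"

text \<open>For positive \<open>A\<close> the value \<open>cinner_wrt A x x\<close> is real, so \<open>Re\<close> loses nothing.\<close>

definition norm_wrt :: "('h::chilbert_space \<Rightarrow>\<^sub>L 'h) \<Rightarrow> 'h \<Rightarrow> real"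
  where "norm_wrt A x = sqrt (Re (cinner_wrt A x x))"

text \<open>
  The supremum is a real one. It is meaningful for nonzero positive \<open>A\<close> and
  \<open>T \<in> sqrt_adjointable_ops A\<close>, where the set of values is nonempty and bounded.
\<close>

definition opnorm_wrt :: "('h::chilbert_space \<Rightarrow>\<^sub>L 'h) \<Rightarrow> real \<Rightarrow> ('h \<Rightarrow>\<^sub>L 'h) \<Rightarrow> real"
  where "opnorm_wrt A l T =
    (SUP x\<in>{x. norm_wrt A x = 1}.
      sqrt (l * (norm_wrt A (T x))\<^sup>2 + (1 - l) * (cmod (cinner_wrt A (T x) x))\<^sup>2))"

end

theory Submission
  imports Defs
begin

text \<open>
  Let \<open>B\<close> be the positive square root of \<open>A\<close>, so that \<open>\<langle>x, y\<rangle>\<^sub>A = \<langle>B x, B y\<rangle>\<close>. Attach to an operator \<open>T\<close> and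
  a vector \<open>x\<close> the vector \<open>v\<^sub>T x = (\<surd>\<lambda> B T x, \<surd>(1 - \<lambda>) \<langle>T x, x\<rangle>\<^sub>A)\<close> of the Hilbert space \<open>\<H> \<times> \<complex>\<close>.
  It is additive in \<open>T\<close>, the seminorm of \<open>T\<close> is the supremum of \<open>\<parallel>v\<^sub>T x\<parallel>\<close> over the \<open>A\<close>-unit vectors,
  and the expression in (ii) is exactly \<open>\<langle>v\<^sub>S x\<^sub>n, v\<^sub>T x\<^sub>n\<rangle>\<close>. So the theorem is an instance of a fact about
  two bounded functions \<open>u\<close>, \<open>w\<close> from a nonempty set into a Hilbert space
  (\<open>sup_norm_add_iff\<close>): the suprema of their norms add up for \<open>u + w\<close> iff along some sequence
  \<open>\<langle>w, u\<rangle>\<close> tends to the product of the suprema. Both directions rest on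
  \<open>\<parallel>u + w\<parallel>\<^sup>2 = \<parallel>u\<parallel>\<^sup>2 + \<parallel>w\<parallel>\<^sup>2 + 2 Re \<langle>w, u\<rangle>\<close> and Cauchy-Schwarz: equality of the suprema forces both norms to
  be asymptotically maximal and the inner product to be asymptotically real and maximal, and conversely.

  Boundedness of \<open>v\<^sub>T\<close> on \<open>A\<close>-unit vectors is where the adjoint \<open>R\<close> enters: \<open>\<langle>B T x, y\<rangle> = \<langle>B x, R y\<rangle>\<close> with
  \<open>y = B T x\<close> gives \<open>\<parallel>B T x\<parallel> \<le> \<parallel>R\<parallel> \<parallel>B x\<parallel>\<close>. Since \<open>B\<close> is given by a definite description, this and the
  formula for \<open>\<langle>x, y\<rangle>\<^sub>A\<close> require the square root theorem (\<open>sqrt_op_square\<close>).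
  After scaling, a root of \<open>1 - K\<close> with \<open>K\<close> a positive contraction is \<open>1 - Y\<close>, where \<open>Y\<close> is the
  limit of the iteration \<open>Y \<mapsto> (K + Y\<^sup>2) / 2\<close>. This root commutes with everything that commutes with \<open>A\<close>,
  in particular with every other root of \<open>A\<close>, which makes it the only one.
\<close>

section \<open>Cauchy-Schwarz for positive operators\<close>

lemma scaleC_diff_right: "c *\<^sub>C (x - y) = c *\<^sub>C x - c *\<^sub>C y"
  by (metis add_diff_cancel_right' diff_add_cancel scaleC_add_right)

lemma cinner_scaleR_left: "cinner (r *\<^sub>R x) y = of_real r * cinner x y"
  by (metis cinner_scaleC_left scaleC_of_real)

lemma cinner_zero_left [simp]: "cinner 0 y = 0"
  using cinner_scaleR_left[of 0 0 y] by simp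

lemma cinner_minus_left: "cinner (- x) y = - cinner x y"
  using cinner_scaleR_left[of "-1" x y] by simp

lemma cinner_diff_left: "cinner (x - y) z = cinner x z - cinner y z"
  using cinner_add_left[of x "- y" z] by (simp add: cinner_minus_left)

lemma cinner_add_right: "cinner z (x + y) = cinner z x + cinner z y"
  by (metis cinner_commute cinner_add_left complex_cnj_add)

lemma cinner_diff_right: "cinner z (x - y) = cinner z x - cinner z y"
  by (metis cinner_commute cinner_diff_left complex_cnj_diff)

lemma cinner_scaleC_right: "cinner x (c *\<^sub>C y) = cnj c * cinner x y"
  by (metis cinner_commute cinner_scaleC_left complex_cnj_mult)

lemma cinner_scaleR_right: "cinner x (r *\<^sub>R y) = of_real r * cinner x y"
  by (metis cinner_scaleC_right complex_cnj_complex_of_real scaleC_of_real)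

lemma cinner_self: "cinner x x = of_real ((norm x)\<^sup>2)"
  using cinner_nonneg[of x]
  by (simp add: norm_eq_sqrt_cinner complex_nonneg_Reals_iff complex_eq_iff)

lemma cinner_ext:
  assumes "\<And>y. cinner u y = cinner v y" shows "u = v"
proof -
  have "cinner (u - v) (u - v) = 0"
    using assms by (simp add: cinner_diff_left)
  then show ?thesis by (simp add: cinner_eq_zero_iff)
qed

text \<open>Polarization: the form is real at \<open>x + y\<close> and at \<open>x + \<i>y\<close>, which fixes the imaginary and the real
  part of the difference between \<open>\<langle>P x, y\<rangle>\<close> and the conjugate of \<open>\<langle>P y, x\<rangle>\<close>.\<close>

lemma positive_op_hermitian:
  assumes "positive_op P"
  shows "cinner (P x) y = cinner x (P y)"
proof -
  define h where "h = (\<lambda>x y. cinner (P x) y)"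
  have P: "P (c *\<^sub>C x) = c *\<^sub>C P x" for c x
    using assms by (simp add: positive_op_def bounded_ops_def)
  have r: "Im (h z z) = 0" for z
    using assms by (simp add: positive_op_def h_def complex_nonneg_Reals_iff)
  have 1: "Im (h x y) + Im (h y x) = 0"
    using r[of "x + y"] r[of x] r[of y]
    by (simp add: h_def blinfun.add_right cinner_add_left cinner_add_right)
  have 2: "Re (h y x) - Re (h x y) = 0"
    using r[of "x + \<i> *\<^sub>C y"] r[of x] r[of y]
    by (simp add: h_def P blinfun.add_right cinner_add_left cinner_add_right
        cinner_scaleC_left cinner_scaleC_right)
  have "h x y = cnj (h y x)"
    using 1 2 by (simp add: complex_eq_iff)
  then show ?thesis
    by (metis cinner_commute h_def)
qed

text \<open>The form need not be definite, so the usual minimizing multiple of \<open>y\<close> may not exist. Evaluating the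
  form at \<open>x - t b y\<close> for all real \<open>t\<close>, with \<open>b = \<langle>P x, y\<rangle>\<close>, covers the degenerate case as well.\<close>

lemma positive_op_Cauchy_Schwarz:
  assumes "positive_op P"
  shows "(cmod (cinner (P x) y))\<^sup>2 \<le> Re (cinner (P x) x) * Re (cinner (P y) y)"
proof -
  define a b c where "a = Re (cinner (P x) x)" and "b = cinner (P x) y"
    and "c = Re (cinner (P y) y)"
  have P: "P (c *\<^sub>C x) = c *\<^sub>C P x" for c x
    using assms by (simp add: positive_op_def bounded_ops_def)
  have nn: "Re (cinner (P z) z) \<ge> 0" "Im (cinner (P z) z) = 0" for z
    using assms by (simp_all add: positive_op_def complex_nonneg_Reals_iff)
  have yx: "cinner (P y) x = cnj b"
    by (metis assms b_def cinner_commute positive_op_hermitian)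
  have q: "0 \<le> a - 2 * t * (cmod b)\<^sup>2 + t\<^sup>2 * (cmod b)\<^sup>2 * c" for t
  proof -
    have "Re (cinner (P (x - (of_real t * b) *\<^sub>C y)) (x - (of_real t * b) *\<^sub>C y))
      = a - 2 * t * (cmod b)\<^sup>2 + t\<^sup>2 * (cmod b)\<^sup>2 * c"
      unfolding cmod_power2
      by (simp add: P blinfun.diff_right cinner_diff_left cinner_diff_right cinner_scaleC_left
          cinner_scaleC_right yx flip: b_def a_def)
        (simp add: a_def c_def nn algebra_simps power2_eq_square)
    then show ?thesis using nn(1) by metis
  qed
  have "(cmod b)\<^sup>2 \<le> a * c"
  proof (cases "c = 0")
    case True
    have "(cmod b)\<^sup>2 \<le> 0"
    proof (rule ccontr)
      assume *: "\<not> (cmod b)\<^sup>2 \<le> 0"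
      then show False
        \<comment> \<open>The form is now affine in \<open>t\<close>; this \<open>t\<close> makes it \<open>- a - 2 < 0\<close>.\<close>
        using q[of "(a + 1) / (cmod b)\<^sup>2"] nn(1)[of x] True
        by (simp add: divide_simps a_def)
    qed
    then show ?thesis using True by simp
  next
    case False
    then have "c > 0" using nn(1)[of y] by (simp add: c_def)
    then show ?thesis using q[of "1 / c"]
      by (simp add: field_simps power2_eq_square)
  qed
  then show ?thesis by (simp add: a_def b_def c_def)
qed

lemma positive_op_id: "positive_op id_blinfun"
  by (simp add: positive_op_def bounded_ops_def cinner_nonneg)

lemma cinner_Cauchy_Schwarz: "cmod (cinner x y) \<le> norm x * norm y"
proof -
  have "(cmod (cinner x y))\<^sup>2 \<le> (norm x * norm y)\<^sup>2"
    using positive_op_Cauchy_Schwarz[OF positive_op_id, of x y]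
    by (simp add: cinner_self power_mult_distrib flip: of_real_power)
  then show ?thesis by (rule power2_le_imp_le) simp
qed

lemma bounded_bilinear_cinner: "bounded_bilinear cinner"
  by (standard; (intro exI[of _ 1] allI)?)
    (simp_all add: cinner_add_left cinner_add_right cinner_scaleR_left cinner_scaleR_right
      cinner_Cauchy_Schwarz scaleR_conv_of_real)

lemma norm_scaleC: "norm (c *\<^sub>C x) = cmod c * norm x"
proof -
  have "complex_of_real ((norm (c *\<^sub>C x))\<^sup>2) = of_real ((cmod c * norm x)\<^sup>2)"
    unfolding cinner_self[symmetric] cinner_scaleC_left cinner_scaleC_right
    by (simp add: cinner_self complex_norm_square[symmetric] power_mult_distrib mult_ac
        flip: mult.assoc)
  then have "(norm (c *\<^sub>C x))\<^sup>2 = (cmod c * norm x)\<^sup>2"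
    using of_real_eq_iff by blast
  then show ?thesis by simp
qed

lemma bounded_linear_scaleC: "bounded_linear (\<lambda>x. c *\<^sub>C x)"
proof (rule bounded_linear_intro)
  show "c *\<^sub>C (r *\<^sub>R x) = r *\<^sub>R (c *\<^sub>C x)" for r x
    by (metis scaleC_of_real scaleC_scaleC mult.commute)
  show "norm (c *\<^sub>C x) \<le> norm x * cmod c" for x
    by (simp add: norm_scaleC)
qed (rule scaleC_add_right)

lemma positive_op_kernel:
  assumes "positive_op P" and "cinner (P x) x = 0"
  shows "P x = 0"
proof (rule cinner_ext)
  show "cinner (P x) y = cinner 0 y" for y
    using positive_op_Cauchy_Schwarz[OF assms(1), of x y] assms(2) by simp
qed

section \<open>The square root of a positive operator\<close>

text \<open>
  If \<open>Y\<close> is a fixed point of \<open>Y \<mapsto> (K + Y\<^sup>2) / 2\<close>, then \<open>(1 - Y)\<^sup>2 = 1 - K\<close>. The iteration from \<open>0\<close> converges in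
  operator norm for every contraction \<open>K\<close>, because it is dominated term by term by the same iteration
  for the number \<open>1\<close> in place of \<open>K\<close>, an increasing sequence bounded by \<open>1\<close>.
\<close>

lemma blinfun_compose_assoc: "(F o\<^sub>L G) o\<^sub>L H = F o\<^sub>L (G o\<^sub>L H)"
  by (rule blinfun_eqI) simp

primrec sqrt_iter :: "('a::banach \<Rightarrow>\<^sub>L 'a) \<Rightarrow> nat \<Rightarrow> ('a \<Rightarrow>\<^sub>L 'a)" where
  "sqrt_iter K 0 = 0"
| "sqrt_iter K (Suc n) = (1/2) *\<^sub>R (K + (sqrt_iter K n o\<^sub>L sqrt_iter K n))"

primrec sqrt_majorant :: "nat \<Rightarrow> real" where
  "sqrt_majorant 0 = 0"
| "sqrt_majorant (Suc n) = (1 + (sqrt_majorant n)\<^sup>2) / 2"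

lemma sqrt_majorant_bounds: "0 \<le> sqrt_majorant n \<and> sqrt_majorant n \<le> 1"
  by (induction n) (auto simp: power_le_one)

lemma convergent_sqrt_majorant: "convergent sqrt_majorant"
proof -
  have "sqrt_majorant n \<le> sqrt_majorant (Suc n)" for n
    using zero_le_power2[of "sqrt_majorant n - 1"] by (simp add: power2_eq_square algebra_simps)
  then have "incseq sqrt_majorant" by (rule incseq_SucI)
  then show ?thesis
    using sqrt_majorant_bounds incseq_convergent[of sqrt_majorant 1] by (metis convergent_def)
qed

lemma norm_sqrt_iter_le:
  assumes "norm K \<le> 1"
  shows "norm (sqrt_iter K n) \<le> sqrt_majorant n"
proof (induction n)
  case (Suc n)
  have "norm (sqrt_iter K n o\<^sub>L sqrt_iter K n) \<le> (sqrt_majorant n)\<^sup>2"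
    unfolding power2_eq_square
    by (rule order_trans[OF norm_blinfun_compose mult_mono])
      (use Suc sqrt_majorant_bounds in auto)
  then have "norm (K + (sqrt_iter K n o\<^sub>L sqrt_iter K n)) \<le> 1 + (sqrt_majorant n)\<^sup>2"
    by (rule norm_triangle_mono[OF assms])
  then show ?case by simp
qed simp

text \<open>The step bound is inherited through \<open>U\<^sup>2 - V\<^sup>2 = U (U - V) + (U - V) V\<close>: inserting norm bounds turns the
  right-hand side into \<open>u (u - v) + (u - v) v = u\<^sup>2 - v\<^sup>2\<close>.\<close>

lemma norm_sqrt_iter_step_le:
  assumes "norm K \<le> 1"
  shows "norm (sqrt_iter K (Suc n) - sqrt_iter K n) \<le> sqrt_majorant (Suc n) - sqrt_majorant n"
proof (induction n)
  case 0
  then show ?case using assms by (simp)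
next
  case (Suc n)
  define U V u v where "U = sqrt_iter K (Suc n)" "V = sqrt_iter K n"
    "u = sqrt_majorant (Suc n)" "v = sqrt_majorant n"
  interpret comp: bounded_bilinear "(o\<^sub>L) :: ('a \<Rightarrow>\<^sub>L 'a) \<Rightarrow> _"
    by (rule bounded_bilinear_blinfun_compose)
  have b: "norm U \<le> u" "norm V \<le> v" "norm (U - V) \<le> u - v" "0 \<le> u" "0 \<le> v"
    using norm_sqrt_iter_le[OF assms] Suc sqrt_majorant_bounds unfolding U_V_u_v_def by blast+
  have "norm (U o\<^sub>L (U - V)) \<le> u * (u - v)"
    by (rule order_trans[OF norm_blinfun_compose mult_mono]) (use b in auto)
  moreover have "norm ((U - V) o\<^sub>L V) \<le> (u - v) * v"
    by (rule order_trans[OF norm_blinfun_compose mult_mono]) (use b order_trans[OF norm_ge_zero b(3)] in auto)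
  ultimately have "norm ((U o\<^sub>L (U - V)) + ((U - V) o\<^sub>L V)) \<le> u\<^sup>2 - v\<^sup>2"
    by (intro norm_triangle_le) (simp add: power2_eq_square algebra_simps)
  moreover have "sqrt_iter K (Suc (Suc n)) = (1/2) *\<^sub>R (K + (U o\<^sub>L U))"
    "sqrt_iter K (Suc n) = (1/2) *\<^sub>R (K + (V o\<^sub>L V))"
    by (simp_all add: U_V_u_v_def)
  then have "sqrt_iter K (Suc (Suc n)) - sqrt_iter K (Suc n)
    = (1/2) *\<^sub>R ((U o\<^sub>L (U - V)) + ((U - V) o\<^sub>L V))"
    by (simp only: comp.diff_left comp.diff_right scaleR_diff_right[symmetric]) simp
  then have "norm (sqrt_iter K (Suc (Suc n)) - sqrt_iter K (Suc n))
    = norm ((U o\<^sub>L (U - V)) + ((U - V) o\<^sub>L V)) / 2"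
    by (simp only: norm_scaleR)
  ultimately have "norm (sqrt_iter K (Suc (Suc n)) - sqrt_iter K (Suc n)) \<le> (1 + u\<^sup>2) / 2 - (1 + v\<^sup>2) / 2"
    by (simp add: diff_divide_distrib[symmetric] del: sqrt_iter.simps)
  then show ?case
    by (simp add: U_V_u_v_def)
qed

lemma convergent_sqrt_iter:
  assumes "norm K \<le> 1"
  shows "convergent (sqrt_iter K)"
proof -
  have dist: "norm (sqrt_iter K n - sqrt_iter K m) \<le> sqrt_majorant n - sqrt_majorant m"
    if "m \<le> n" for m n
    using that
  proof (induction n rule: dec_induct)
    case (step n)
    then show ?case
      using norm_triangle_ineq[of "sqrt_iter K (Suc n) - sqrt_iter K n" "sqrt_iter K n - sqrt_iter K m"]
        norm_sqrt_iter_step_le[OF assms, of n]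
      by (simp del: sqrt_iter.simps sqrt_majorant.simps)
  qed simp
  have "Cauchy (sqrt_iter K)"
  proof (rule metric_CauchyI)
    fix e :: real assume "e > 0"
    then obtain M where M: "\<And>m n. m \<ge> M \<Longrightarrow> n \<ge> M \<Longrightarrow> dist (sqrt_majorant m) (sqrt_majorant n) < e"
      using convergent_Cauchy[OF convergent_sqrt_majorant] metric_CauchyD by blast
    have "dist (sqrt_iter K m) (sqrt_iter K n) < e" if "m \<ge> M" "n \<ge> M" for m n
    proof (cases "m \<le> n")
      case True
      then show ?thesis
        using dist[OF True] M[OF that] by (simp add: dist_norm norm_minus_commute)
    next
      case False
      then have "n \<le> m" by simp
      then show ?thesis
        using dist[of n m] M[OF that] by (simp add: dist_norm)
    qed
    then show "\<exists>M. \<forall>m\<ge>M. \<forall>n\<ge>M. dist (sqrt_iter K m) (sqrt_iter K n) < e" by blast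
  qed
  then show ?thesis by (rule Cauchy_convergent)
qed

lemma sqrt_iter_commute:
  assumes "D o\<^sub>L K = K o\<^sub>L D"
  shows "D o\<^sub>L sqrt_iter K n = sqrt_iter K n o\<^sub>L D"
proof (induction n)
  case (Suc n)
  interpret comp: bounded_bilinear "(o\<^sub>L) :: ('a \<Rightarrow>\<^sub>L 'a) \<Rightarrow> _"
    by (rule bounded_bilinear_blinfun_compose)
  have "D o\<^sub>L (sqrt_iter K n o\<^sub>L sqrt_iter K n) = (sqrt_iter K n o\<^sub>L sqrt_iter K n) o\<^sub>L D"
    by (metis Suc blinfun_compose_assoc)
  then show ?case
    using assms by (simp add: comp.add_left comp.add_right comp.scaleR_left comp.scaleR_right)
qed (simp add: blinfun_eqI)

lemma sqrt_iter_hermitian: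
  fixes K :: "'a::chilbert_space \<Rightarrow>\<^sub>L 'a"
  assumes "\<And>x y. cinner (K x) y = cinner x (K y)"
  shows "cinner (sqrt_iter K n x) y = cinner x (sqrt_iter K n y)"
  by (induction n arbitrary: x y)
    (simp_all add: assms blinfun.add_left blinfun.scaleR_left cinner_scaleR_left cinner_scaleR_right
      cinner_add_left cinner_add_right cinner_commute[of _ 0])

lemma positive_op_scaleR:
  assumes "positive_op P" and "0 \<le> r"
  shows "positive_op (r *\<^sub>R P)"
proof -
  have "r *\<^sub>R c *\<^sub>C P x = c *\<^sub>C r *\<^sub>R P x" for c x
    by (metis scaleC_of_real scaleC_scaleC mult.commute)
  then show ?thesis
    using assms by (simp add: positive_op_def bounded_ops_def blinfun.scaleR_left
      cinner_scaleR_left complex_nonneg_Reals_iff)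
qed

text \<open>The Cauchy-Schwarz inequality of the form \<open>\<langle>K x, y\<rangle>\<close> at \<open>y = K x\<close> bounds \<open>\<parallel>K x\<parallel>\<^sup>4\<close> by \<open>\<parallel>x\<parallel>\<^sup>2 \<parallel>K x\<parallel>\<^sup>2\<close>.\<close>

lemma norm_positive_op_le_1:
  assumes "positive_op K" and "\<And>x. Re (cinner (K x) x) \<le> (norm x)\<^sup>2"
  shows "norm K \<le> 1"
proof (rule norm_blinfun_bound)
  fix x
  have "(cmod (cinner (K x) (K x)))\<^sup>2 \<le> Re (cinner (K x) x) * Re (cinner (K (K x)) (K x))"
    using positive_op_Cauchy_Schwarz[OF assms(1)] .
  also have "\<dots> \<le> (norm x)\<^sup>2 * (norm (K x))\<^sup>2"
    using assms(1) by (intro mult_mono assms(2)) (auto simp: positive_op_def complex_nonneg_Reals_iff)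
  finally have "(norm (K x))\<^sup>2 * (norm (K x))\<^sup>2 \<le> (norm x)\<^sup>2 * (norm (K x))\<^sup>2"
    by (simp add: cinner_self power2_eq_square norm_mult)
  then have "norm (K x) = 0 \<or> (norm (K x))\<^sup>2 \<le> (norm x)\<^sup>2"
    by (metis mult_right_le_imp_le zero_less_power2)
  then show "norm (K x) \<le> 1 * norm x"
    using power2_le_imp_le[of "norm (K x)" "norm x"] by auto
qed simp

text \<open>Symmetry and commutation pass from the iterates to the limit \<open>Y\<close>; positivity of \<open>1 - Y\<close> is
  \<open>\<parallel>Y\<parallel> \<le> 1\<close>. The commutation clause serves the uniqueness of square roots.\<close>

lemma ex_sqrt_of_one_minus:
  assumes K: "positive_op K" and nK: "norm K \<le> 1"
  obtains B where "positive_op B" and "B o\<^sub>L B = id_blinfun - K"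
    and "\<And>D. D o\<^sub>L K = K o\<^sub>L D \<Longrightarrow> D o\<^sub>L B = B o\<^sub>L D"
proof -
  interpret comp: bounded_bilinear "(o\<^sub>L) :: ('a \<Rightarrow>\<^sub>L 'a) \<Rightarrow> _"
    by (rule bounded_bilinear_blinfun_compose)
  obtain Y where Y: "sqrt_iter K \<longlonglongrightarrow> Y"
    using convergent_sqrt_iter[OF nK] by (auto simp: convergent_def)
  have "(\<lambda>n. sqrt_iter K (Suc n)) \<longlonglongrightarrow> (1/2) *\<^sub>R (K + (Y o\<^sub>L Y))"
    unfolding sqrt_iter.simps by (intro tendsto_intros comp.tendsto Y)
  then have fixpoint: "Y = (1/2) *\<^sub>R (K + (Y o\<^sub>L Y))"
    using LIMSEQ_Suc[OF Y] LIMSEQ_unique by blast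
  have comm: "D o\<^sub>L Y = Y o\<^sub>L D" if "D o\<^sub>L K = K o\<^sub>L D" for D
  proof (rule LIMSEQ_unique)
    show "(\<lambda>n. D o\<^sub>L sqrt_iter K n) \<longlonglongrightarrow> (D o\<^sub>L Y)"
      by (intro comp.tendsto tendsto_const Y)
    show "(\<lambda>n. D o\<^sub>L sqrt_iter K n) \<longlonglongrightarrow> (Y o\<^sub>L D)"
      unfolding sqrt_iter_commute[OF that] by (intro comp.tendsto tendsto_const Y)
  qed
  have herm: "cinner (Y x) y = cinner x (Y y)" for x y
  proof -
    have "(\<lambda>n. sqrt_iter K n z) \<longlonglongrightarrow> Y z" for z
      by (intro blinfun.tendsto Y tendsto_const)
    then have "(\<lambda>n. cinner (sqrt_iter K n x) y) \<longlonglongrightarrow> cinner (Y x) y"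
      "(\<lambda>n. cinner x (sqrt_iter K n y)) \<longlonglongrightarrow> cinner x (Y y)"
      by (intro bounded_bilinear.tendsto[OF bounded_bilinear_cinner] tendsto_const; blast)+
    then show ?thesis
      using sqrt_iter_hermitian[OF positive_op_hermitian[OF K]] LIMSEQ_unique by auto
  qed
  have nY: "norm Y \<le> 1"
    using norm_sqrt_iter_le[OF nK] sqrt_majorant_bounds
    by (intro LIMSEQ_le_const2[OF tendsto_norm[OF Y]]) (meson order_trans)
  have lin: "Y (c *\<^sub>C x) = c *\<^sub>C Y x" for c x
  proof -
    have D: "blinfun_apply (Blinfun (\<lambda>x. c *\<^sub>C x)) = (\<lambda>x::'a. c *\<^sub>C x)"
      by (rule bounded_linear_Blinfun_apply[OF bounded_linear_scaleC])
    \<comment> \<open>Complex linearity of \<open>Y\<close> is commutation with multiplication by the scalar \<open>c\<close>.\<close>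
    have "Blinfun (\<lambda>x. c *\<^sub>C x) o\<^sub>L K = K o\<^sub>L Blinfun (\<lambda>x. c *\<^sub>C x)"
      using K by (intro blinfun_eqI) (simp add: D positive_op_def bounded_ops_def)
    from arg_cong[OF comm[OF this], of "\<lambda>F. blinfun_apply F x"] show ?thesis
      by (simp add: D)
  qed
  show thesis
  proof (rule that[of "id_blinfun - Y"])
    have "Re (cinner (Y x) x) \<le> (norm x)\<^sup>2" for x
    proof -
      have "Re (cinner (Y x) x) \<le> norm (Y x) * norm x"
        using complex_Re_le_cmod cinner_Cauchy_Schwarz order_trans by blast
      also have "\<dots> \<le> norm x * norm x"
        using norm_blinfun[of Y x] mult_right_mono[OF nY norm_ge_zero[of x]]
        by (intro mult_right_mono) auto
      finally show ?thesis by (simp add: power2_eq_square)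
    qed
    moreover have "Im (cinner (Y x) x) = 0" for x
      using herm[of x x] cinner_commute[of x "Y x"] by (simp add: complex_eq_iff)
    ultimately show "positive_op (id_blinfun - Y)"
      by (auto simp: positive_op_def bounded_ops_def blinfun.diff_left lin scaleC_diff_right cinner_diff_left
          complex_nonneg_Reals_iff cinner_self simp flip: of_real_power)
    have "2 *\<^sub>R Y = K + (Y o\<^sub>L Y)"
      by (subst fixpoint) simp
    then have "Y x + Y x = K x + Y (Y x)" for x
      by (metis blinfun.add_left blinfun_apply_blinfun_compose scaleR_2)
    then show "(id_blinfun - Y) o\<^sub>L (id_blinfun - Y) = id_blinfun - K"
      by (intro blinfun_eqI) (simp add: blinfun.diff_left blinfun.diff_right algebra_simps)
    show "D o\<^sub>L (id_blinfun - Y) = (id_blinfun - Y) o\<^sub>L D" if "D o\<^sub>L K = K o\<^sub>L D" for D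
      using comm[OF that] by (simp add: comp.diff_left comp.diff_right blinfun_eqI)
  qed
qed

lemma ex_sqrt_commuting:
  assumes "positive_op A"
  obtains B where "positive_op B" and "B o\<^sub>L B = A"
    and "\<And>D. D o\<^sub>L A = A o\<^sub>L D \<Longrightarrow> D o\<^sub>L B = B o\<^sub>L D"
proof -
  interpret comp: bounded_bilinear "(o\<^sub>L) :: ('a \<Rightarrow>\<^sub>L 'a) \<Rightarrow> _"
    by (rule bounded_bilinear_blinfun_compose)
  \<comment> \<open>Any \<open>m \<ge> \<parallel>A\<parallel>\<close> makes \<open>1 - A / m\<close> a positive contraction; the summand \<open>1\<close> ensures \<open>m > 0\<close>.\<close>
  define m where "m = norm A + 1"
  have m: "m > 0" by (simp add: m_def add_nonneg_pos)
  define K where "K = id_blinfun - (1/m) *\<^sub>R A"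
  have A': "positive_op ((1/m) *\<^sub>R A)"
    using m by (intro positive_op_scaleR assms) simp
  have le: "Re (cinner (A x) x) \<le> m * (norm x)\<^sup>2" for x
  proof -
    have "Re (cinner (A x) x) \<le> norm (A x) * norm x"
      using complex_Re_le_cmod cinner_Cauchy_Schwarz order_trans by blast
    also have "\<dots> \<le> (norm A * norm x) * norm x"
      by (intro mult_right_mono norm_blinfun) simp
    also have "\<dots> \<le> m * (norm x)\<^sup>2"
      by (simp add: m_def power2_eq_square algebra_simps)
    finally show ?thesis .
  qed
  have K: "positive_op K"
    using A' m le
    by (auto simp: positive_op_def K_def bounded_ops_def blinfun.diff_left blinfun.scaleR_left scaleC_diff_right
      cinner_diff_left cinner_scaleR_left complex_nonneg_Reals_iff cinner_self field_simps
      simp flip: of_real_power)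
  have "Re (cinner (K x) x) \<le> (norm x)\<^sup>2" for x
    using A' by (auto simp: positive_op_def K_def blinfun.diff_left cinner_diff_left 
      complex_nonneg_Reals_iff cinner_self simp flip: of_real_power)
  then obtain B where B: "positive_op B" "B o\<^sub>L B = id_blinfun - K"
    and comm: "\<And>D. D o\<^sub>L K = K o\<^sub>L D \<Longrightarrow> D o\<^sub>L B = B o\<^sub>L D"
    using ex_sqrt_of_one_minus[OF K norm_positive_op_le_1[OF K]] by blast
  show thesis
  proof (rule that[of "sqrt m *\<^sub>R B"])
    show "positive_op (sqrt m *\<^sub>R B)"
      using m B(1) by (intro positive_op_scaleR) auto
    show "(sqrt m *\<^sub>R B) o\<^sub>L (sqrt m *\<^sub>R B) = A"
      using m B(2) by (simp add: comp.scaleR_left comp.scaleR_right K_def)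
    show "D o\<^sub>L (sqrt m *\<^sub>R B) = (sqrt m *\<^sub>R B) o\<^sub>L D" if "D o\<^sub>L A = A o\<^sub>L D" for D
    proof -
      have "D o\<^sub>L id_blinfun = id_blinfun o\<^sub>L D" by (intro blinfun_eqI) simp
      then have "D o\<^sub>L K = K o\<^sub>L D"
        using that by (simp add: K_def comp.diff_left comp.diff_right comp.scaleR_left comp.scaleR_right)
      then show ?thesis
        using comm by (simp add: comp.scaleR_left comp.scaleR_right)
    qed
  qed
qed

text \<open>For \<open>y = (B - C) x\<close> one has \<open>(B + C) y = (B\<^sup>2 - C\<^sup>2) x = 0\<close>. By positivity \<open>B y\<close> and \<open>C y\<close> vanish separately,
  whence \<open>\<parallel>y\<parallel>\<^sup>2 = \<langle>x, (B - C) y\<rangle> = 0\<close>.\<close>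

lemma commuting_sqrt_unique:
  assumes B: "positive_op B" and C: "positive_op C" and sq: "B o\<^sub>L B = C o\<^sub>L C"
    and comm: "C o\<^sub>L B = B o\<^sub>L C"
  shows "C = B"
proof (rule blinfun_eqI)
  have ptw: "B (B z) = C (C z)" "C (B z) = B (C z)" for z
    using arg_cong[OF sq, of "\<lambda>F. blinfun_apply F z"] arg_cong[OF comm, of "\<lambda>F. blinfun_apply F z"]
    by simp_all
  fix x
  define y where "y = B x - C x"
  have "B y + C y = 0"
    by (simp add: y_def blinfun.diff_right ptw)
  then have s: "cinner (B y) y + cinner (C y) y = 0"
    by (metis cinner_add_left cinner_zero_left)
  have "cinner (B y) y \<in> \<real>\<^sub>\<ge>\<^sub>0" "cinner (C y) y \<in> \<real>\<^sub>\<ge>\<^sub>0"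
    using B C by (auto simp: positive_op_def)
  with s have "cinner (B y) y = 0" "cinner (C y) y = 0"
    by (auto simp: complex_nonneg_Reals_iff complex_eq_iff)
  then have "B y = 0" "C y = 0"
    using B C positive_op_kernel by blast+
  then have "cinner y y = 0"
    using positive_op_hermitian[OF B, of x y] positive_op_hermitian[OF C, of x y]
      cinner_commute[of x 0]
    by (subst (1) y_def) (simp add: cinner_diff_left)
  then show "C x = B x" by (simp add: cinner_eq_zero_iff y_def)
qed

lemma sqrt_op_square:
  assumes "positive_op A"
  shows "positive_op (sqrt_op A)" and "sqrt_op A o\<^sub>L sqrt_op A = A"
proof -
  obtain B where B: "positive_op B" "B o\<^sub>L B = A"
    and comm: "\<And>D. D o\<^sub>L A = A o\<^sub>L D \<Longrightarrow> D o\<^sub>L B = B o\<^sub>L D"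
    using ex_sqrt_commuting[OF assms] by blast
  have "C = B" if "positive_op C \<and> C o\<^sub>L C = A" for C
  proof (rule commuting_sqrt_unique[OF B(1)])
    \<comment> \<open>\<open>C\<close> commutes with its own square \<open>A\<close>.\<close>
    show "C o\<^sub>L B = B o\<^sub>L C"
      using that by (intro comm) (metis blinfun_compose_assoc)
  qed (use that B in auto)
  then have "\<exists>!C. positive_op C \<and> C o\<^sub>L C = A"
    using B by blast
  from theI'[OF this] have "positive_op (sqrt_op A) \<and> sqrt_op A o\<^sub>L sqrt_op A = A"
    unfolding sqrt_op_def .
  then show "positive_op (sqrt_op A)" and "sqrt_op A o\<^sub>L sqrt_op A = A" by auto
qed

section \<open>Additivity of suprema of norms\<close>

lemma norm_add_square_cinner:
  fixes u w :: "'k::chilbert_space"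
  shows "(norm (u + w))\<^sup>2 = (norm u)\<^sup>2 + (norm w)\<^sup>2 + 2 * Re (cinner w u)"
proof -
  have "complex_of_real ((norm (u + w))\<^sup>2)
    = of_real ((norm u)\<^sup>2) + of_real ((norm w)\<^sup>2) + (cinner w u + cnj (cinner w u))"
    unfolding cinner_self[symmetric]
    by (simp add: cinner_add_left cinner_add_right flip: cinner_commute[of u w])
  then show ?thesis
    by (simp add: complex_eq_iff flip: of_real_power)
qed

text \<open>When \<open>c\<close> bounds the modulus, \<open>(Im z)\<^sup>2 \<le> c\<^sup>2 - (Re z)\<^sup>2\<close>, so the imaginary part is squeezed to \<open>0\<close>.\<close>

lemma tendsto_of_norm_le_of_Re:
  assumes "\<And>n. cmod (z n) \<le> c" and "(\<lambda>n. Re (z n)) \<longlonglongrightarrow> c"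
  shows "z \<longlonglongrightarrow> of_real c"
proof -
  have "(\<lambda>n. c\<^sup>2 - (Re (z n))\<^sup>2) \<longlonglongrightarrow> c\<^sup>2 - c\<^sup>2"
    by (intro tendsto_intros assms(2))
  moreover have "(Im (z n))\<^sup>2 \<le> c\<^sup>2 - (Re (z n))\<^sup>2" for n
    using power_mono[OF assms(1)[of n] norm_ge_zero, of 2] by (simp add: cmod_power2)
  ultimately have "(\<lambda>n. (Im (z n))\<^sup>2) \<longlonglongrightarrow> 0"
    using tendsto_sandwich[of "\<lambda>_. 0" "\<lambda>n. (Im (z n))\<^sup>2" sequentially
        "\<lambda>n. c\<^sup>2 - (Re (z n))\<^sup>2" 0] by simp
  from tendsto_real_sqrt[OF this] have "(\<lambda>n. Im (z n)) \<longlonglongrightarrow> 0"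
    by (simp add: tendsto_rabs_zero_iff)
  then show ?thesis
    using assms(2) by (simp add: tendsto_complex_iff)
qed

text \<open>
  From additivity: choose \<open>x\<^sub>n\<close> with \<open>\<parallel>u + w\<parallel>\<close> tending to \<open>N u + N w\<close>. The triangle inequality leaves
  \<open>\<parallel>u\<parallel>\<close> and \<open>\<parallel>w\<parallel>\<close> no choice but to tend to \<open>N u\<close> and \<open>N w\<close>, and the expansion of \<open>\<parallel>u + w\<parallel>\<^sup>2\<close> then yields the
  limit of \<open>Re \<langle>w, u\<rangle>\<close>. Conversely, Cauchy-Schwarz gives \<open>Re \<langle>w, u\<rangle> \<le> \<parallel>u\<parallel> N w\<close>, so the limit forces
  \<open>\<parallel>u\<parallel>\<close> to tend to \<open>N u\<close> unless \<open>N w = 0\<close>, likewise for \<open>w\<close>, and \<open>\<parallel>u + w\<parallel>\<^sup>2\<close> tends to \<open>(N u + N w)\<^sup>2\<close>.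
  If \<open>N u\<close> or \<open>N w\<close> vanishes, the sequence carries no information, but additivity is trivial.
\<close>

lemma sup_norm_add_iff:
  fixes u w :: "'x \<Rightarrow> 'k::chilbert_space" and X :: "'x set"
  defines "N \<equiv> \<lambda>f :: 'x \<Rightarrow> 'k. SUP x\<in>X. norm (f x)"
  assumes ne: "X \<noteq> {}" and bu: "bounded (u ` X)" and bw: "bounded (w ` X)"
  shows "N (\<lambda>x. u x + w x) = N u + N w \<longleftrightarrow>
    (\<exists>x. (\<forall>n. x n \<in> X) \<and> (\<lambda>n. cinner (w (x n)) (u (x n))) \<longlonglongrightarrow> of_real (N u * N w))"
    (is "?add \<longleftrightarrow> ?seq")
proof -
  have bdd: "bdd_above ((\<lambda>x. norm (f x)) ` X)" if "bounded (f ` X)" for f :: "'x \<Rightarrow> 'k"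
    using that by (auto simp: bounded_iff bdd_above_def)
  have upper: "norm (f x) \<le> N f" if "bounded (f ` X)" "x \<in> X" for f x
    unfolding N_def using bdd that by (intro cSUP_upper) auto
  have least: "N f \<le> c" if "\<And>x. x \<in> X \<Longrightarrow> norm (f x) \<le> c" for f c
    unfolding N_def using ne that by (rule cSUP_least)
  have b: "bounded ((\<lambda>x. u x + w x) ` X)"
    using bounded_plus_comp[OF bu bw] .
  have pos: "0 \<le> N u" "0 \<le> N w"
    using ne upper[OF bu] upper[OF bw] norm_ge_zero order_trans by blast+
  have tri: "N (\<lambda>x. u x + w x) \<le> N u + N w"
    by (intro least norm_triangle_mono upper bu bw)
  have CS: "cmod (cinner (w x) (u x)) \<le> norm (u x) * norm (w x)" for x
    using cinner_Cauchy_Schwarz by (metis mult.commute)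
  show ?thesis
  proof
    assume add: ?add
    have "\<exists>x\<in>X. N u + N w - 1 / real (Suc n) < norm (u x + w x)" for n
      using less_cSUP_iff[OF ne bdd[OF b], of "N u + N w - 1 / real (Suc n)"] add
      by (simp add: N_def)
    then obtain x where x: "\<And>n. x n \<in> X"
      and lb: "\<And>n. N u + N w - 1 / real (Suc n) < norm (u (x n) + w (x n))"
      by metis
    have inv: "(\<lambda>n. c - 1 / real (Suc n)) \<longlonglongrightarrow> c" for c :: real
      using tendsto_diff[OF tendsto_const[of c] LIMSEQ_inverse_real_of_nat]
      by (simp add: inverse_eq_divide)
    have bounds: "norm (u (x n)) \<le> N u" "norm (w (x n)) \<le> N w"
      "norm (u (x n) + w (x n)) \<le> norm (u (x n)) + norm (w (x n))" for n
      using upper bu bw x norm_triangle_ineq by blast+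
    have "(\<lambda>n. norm (u (x n))) \<longlonglongrightarrow> N u"
    proof (rule tendsto_sandwich[OF _ _ inv tendsto_const])
      show "\<forall>\<^sub>F n in sequentially. N u - 1 / real (Suc n) \<le> norm (u (x n))"
        using bounds(2,3) lb by (intro always_eventually allI) (smt (verit))
    qed (use bounds in auto)
    moreover have "(\<lambda>n. norm (w (x n))) \<longlonglongrightarrow> N w"
    proof (rule tendsto_sandwich[OF _ _ inv tendsto_const])
      show "\<forall>\<^sub>F n in sequentially. N w - 1 / real (Suc n) \<le> norm (w (x n))"
        using bounds(1,3) lb by (intro always_eventually allI) (smt (verit))
    qed (use bounds in auto)
    moreover have "(\<lambda>n. norm (u (x n) + w (x n))) \<longlonglongrightarrow> N u + N w"
    proof (rule tendsto_sandwich[OF _ _ inv tendsto_const])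
      show "\<forall>\<^sub>F n in sequentially. norm (u (x n) + w (x n)) \<le> N u + N w"
        using bounds by (intro always_eventually allI) (smt (verit))
      show "\<forall>\<^sub>F n in sequentially. N u + N w - 1 / real (Suc n) \<le> norm (u (x n) + w (x n))"
        using lb by (intro always_eventually allI less_imp_le)
    qed
    ultimately have "(\<lambda>n. ((norm (u (x n) + w (x n)))\<^sup>2 - (norm (u (x n)))\<^sup>2 - (norm (w (x n)))\<^sup>2) / 2)
        \<longlonglongrightarrow> ((N u + N w)\<^sup>2 - (N u)\<^sup>2 - (N w)\<^sup>2) / 2"
      by (intro tendsto_intros) auto
    then have "(\<lambda>n. Re (cinner (w (x n)) (u (x n)))) \<longlonglongrightarrow> N u * N w"
      by (simp add: norm_add_square_cinner power2_sum)
    moreover have "cmod (cinner (w (x n)) (u (x n))) \<le> N u * N w" for n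
      by (rule order_trans[OF CS mult_mono[OF bounds(1,2) pos(1) norm_ge_zero]])
    ultimately have "(\<lambda>n. cinner (w (x n)) (u (x n))) \<longlonglongrightarrow> of_real (N u * N w)"
      by (intro tendsto_of_norm_le_of_Re)
    with x show ?seq by blast
  next
    assume ?seq
    then obtain x where x: "\<And>n. x n \<in> X"
      and lim: "(\<lambda>n. cinner (w (x n)) (u (x n))) \<longlonglongrightarrow> of_real (N u * N w)" by blast
    note bounds = upper[OF bu x] upper[OF bw x]
    have ge: "N u + N w \<le> N (\<lambda>x. u x + w x)"
    proof (cases "N u = 0 \<or> N w = 0")
      case True
      then show ?thesis
      proof
        assume 0: "N u = 0"
        have "u x = 0" if "x \<in> X" for x
          using upper[OF bu that] 0 by simp
        then have "N w \<le> N (\<lambda>x. u x + w x)"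
          using upper[OF b] by (intro least) force
        then show ?thesis using 0 by simp
      next
        assume 0: "N w = 0"
        have "w x = 0" if "x \<in> X" for x
          using upper[OF bw that] 0 by simp
        then have "N u \<le> N (\<lambda>x. u x + w x)"
          using upper[OF b] by (intro least) force
        then show ?thesis using 0 by simp
      qed
    next
      case False
      then have pos': "0 < N u" "0 < N w" using pos by auto
      have Re: "(\<lambda>n. Re (cinner (w (x n)) (u (x n)))) \<longlonglongrightarrow> N u * N w"
        using tendsto_Re[OF lim] by simp
      have le: "Re (cinner (w (x n)) (u (x n))) \<le> norm (u (x n)) * norm (w (x n))" for n
        using CS complex_Re_le_cmod order_trans by blast
      have "(\<lambda>n. norm (u (x n))) \<longlonglongrightarrow> N u"
      proof (rule tendsto_sandwich)
        show "(\<lambda>n. Re (cinner (w (x n)) (u (x n))) / N w) \<longlonglongrightarrow> N u"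
          using tendsto_divide[OF Re tendsto_const, of "N w"] pos' by simp
        show "\<forall>\<^sub>F n in sequentially. Re (cinner (w (x n)) (u (x n))) / N w \<le> norm (u (x n))"
          using le bounds(2) pos' order_trans[OF le mult_left_mono[OF bounds(2) norm_ge_zero]]
          by (simp add: pos_divide_le_eq)
      qed (use bounds in auto)
      moreover have "(\<lambda>n. norm (w (x n))) \<longlonglongrightarrow> N w"
      proof (rule tendsto_sandwich)
        show "(\<lambda>n. Re (cinner (w (x n)) (u (x n))) / N u) \<longlonglongrightarrow> N w"
          using tendsto_divide[OF Re tendsto_const, of "N u"] pos' by simp
        show "\<forall>\<^sub>F n in sequentially. Re (cinner (w (x n)) (u (x n))) / N u \<le> norm (w (x n))"
          using order_trans[OF le mult_right_mono[OF bounds(1) norm_ge_zero]] pos'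
          by (simp add: pos_divide_le_eq mult.commute)
      qed (use bounds in auto)
      ultimately have "(\<lambda>n. (norm (u (x n) + w (x n)))\<^sup>2) \<longlonglongrightarrow> (N u)\<^sup>2 + (N w)\<^sup>2 + 2 * (N u * N w)"
        unfolding norm_add_square_cinner by (intro tendsto_intros Re)
      then have "(N u + N w)\<^sup>2 \<le> (N (\<lambda>x. u x + w x))\<^sup>2"
        using power_mono[OF upper[OF b x] norm_ge_zero, where n = 2]
        by (intro LIMSEQ_le_const2) (auto simp: power2_sum mult.assoc)
      moreover have "0 \<le> N (\<lambda>x. u x + w x)"
        using upper[OF b x] norm_ge_zero order_trans by blast
      ultimately show ?thesis by (rule power2_le_imp_le)
    qed
    then show ?add using tri by simp
  qed
qed

section \<open>Products of Hilbert spaces\<close>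

instantiation prod :: (chilbert_space, chilbert_space) chilbert_space
begin

definition scaleC_prod :: "complex \<Rightarrow> 'a \<times> 'b \<Rightarrow> 'a \<times> 'b"
  where "scaleC_prod c p = (c *\<^sub>C fst p, c *\<^sub>C snd p)"

definition cinner_prod :: "'a \<times> 'b \<Rightarrow> 'a \<times> 'b \<Rightarrow> complex"
  where "cinner_prod p q = cinner (fst p) (fst q) + cinner (snd p) (snd q)"

instance
proof
  fix p q r :: "'a \<times> 'b" and c d :: complex and s :: real
  show "c *\<^sub>C (p + q) = c *\<^sub>C p + c *\<^sub>C q" "(c + d) *\<^sub>C p = c *\<^sub>C p + d *\<^sub>C p"
    "c *\<^sub>C d *\<^sub>C p = (c * d) *\<^sub>C p" "complex_of_real s *\<^sub>C p = s *\<^sub>R p"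
    by (simp_all add: scaleC_prod_def scaleC_add_right scaleC_add_left scaleC_scaleC scaleC_of_real
        prod_eq_iff)
  show "cinner p q = cnj (cinner q p)"
    by (simp add: cinner_prod_def flip: cinner_commute)
  show "cinner (p + q) r = cinner p r + cinner q r" "cinner (c *\<^sub>C p) q = c * cinner p q"
    by (simp_all add: cinner_prod_def scaleC_prod_def cinner_add_left cinner_scaleC_left algebra_simps)
  have self: "cinner p p = of_real ((norm (fst p))\<^sup>2 + (norm (snd p))\<^sup>2)"
    by (simp add: cinner_prod_def cinner_self)
  show "cinner p p \<in> \<real>\<^sub>\<ge>\<^sub>0"
    unfolding self by (simp add: complex_nonneg_Reals_iff flip: of_real_power of_real_add)
  show "cinner p p = 0 \<longleftrightarrow> p = 0"
    unfolding self of_real_eq_0_iff by (simp add: sum_power2_eq_zero_iff prod_eq_iff)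
  show "norm p = sqrt (Re (cinner p p))"
    unfolding self by (simp add: norm_prod_def flip: of_real_power of_real_add)
qed

end

section \<open>The norm with respect to a positive operator\<close>

lemma cinner_wrt_sqrt_op:
  assumes "positive_op A"
  shows "cinner_wrt A x y = cinner (sqrt_op A x) (sqrt_op A y)"
  using sqrt_op_square[OF assms] positive_op_hermitian
  by (metis blinfun_apply_blinfun_compose cinner_wrt_def)

lemma norm_wrt_sqrt_op:
  assumes "positive_op A"
  shows "norm_wrt A x = norm (sqrt_op A x)"
  by (simp add: norm_wrt_def cinner_wrt_sqrt_op[OF assms] norm_eq_sqrt_cinner)

lemma ex_norm_wrt_eq_1:
  assumes A: "positive_op A" and "A \<noteq> 0"
  obtains x where "norm_wrt A x = 1"
proof -
  have "sqrt_op A \<noteq> 0"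
    using assms sqrt_op_square(2)[OF A] by (auto)
  then obtain z where z: "sqrt_op A z \<noteq> 0"
    by (metis blinfun_eqI zero_blinfun.rep_eq)
  have "norm_wrt A ((1 / norm (sqrt_op A z)) *\<^sub>R z) = 1"
    using z by (simp add: norm_wrt_sqrt_op[OF A] blinfun.scaleR_right)
  then show thesis by (rule that)
qed

text \<open>Testing the adjoint identity at \<open>y = B T x\<close>, with \<open>B\<close> the square root of \<open>A\<close>, shows that \<open>\<parallel>R\<parallel>\<close> is a
  bound of \<open>T\<close> in the seminorm.\<close>

lemma sqrt_adjointable_norm_wrt_le:
  fixes A T :: "'h::chilbert_space \<Rightarrow>\<^sub>L 'h"
  assumes A: "positive_op A" and "T \<in> sqrt_adjointable_ops A"
  obtains r where "0 \<le> r" and "\<And>x. norm_wrt A (T x) \<le> r * norm_wrt A x"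
proof -
  obtain R :: "'h \<Rightarrow>\<^sub>L 'h" where R: "\<And>x y. cinner (sqrt_op A (T x)) y = cinner (sqrt_op A x) (R y)"
    using assms(2) by (auto simp: sqrt_adjointable_ops_def is_adjoint_wrt_def)
  have "norm_wrt A (T x) \<le> norm R * norm_wrt A x" for x
  proof -
    let ?v = "sqrt_op A (T x)"
    have "norm ?v * norm ?v = cmod (cinner ?v ?v)"
      by (simp add: cinner_self norm_mult power2_eq_square)
    also have "\<dots> \<le> norm (sqrt_op A x) * norm (R ?v)"
      unfolding R by (rule cinner_Cauchy_Schwarz)
    also have "\<dots> \<le> norm (sqrt_op A x) * (norm R * norm ?v)"
      by (intro mult_left_mono norm_blinfun) simp
    finally have "norm ?v * norm ?v \<le> (norm R * norm (sqrt_op A x)) * norm ?v"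
      by (simp add: mult_ac)
    then show ?thesis
      unfolding norm_wrt_sqrt_op[OF A]
      by (cases "?v = 0") (auto dest: mult_right_le_imp_le)
  qed
  then show thesis using that norm_ge_zero by blast
qed

text \<open>The square root of \<open>A\<close> in the first component turns the seminorm of \<open>A\<close> into the norm of the space, so that
  the two weighted terms under the root in \<open>opnorm_wrt\<close> become one genuine Hilbert space norm.\<close>

definition opnorm_vector ::
    "('h::chilbert_space \<Rightarrow>\<^sub>L 'h) \<Rightarrow> real \<Rightarrow> ('h \<Rightarrow>\<^sub>L 'h) \<Rightarrow> 'h \<Rightarrow> 'h \<times> complex"
  where "opnorm_vector A l T x =
    (sqrt l *\<^sub>R sqrt_op A (T x), of_real (sqrt (1 - l)) * cinner_wrt A (T x) x)"

lemma opnorm_vector_add: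
  "opnorm_vector A l (T + S) x = opnorm_vector A l T x + opnorm_vector A l S x"
  by (simp add: opnorm_vector_def cinner_wrt_def blinfun.add_left blinfun.add_right
      scaleR_add_right cinner_add_left distrib_left)

lemma cinner_opnorm_vector:
  assumes A: "positive_op A" and l: "0 \<le> l" "l \<le> 1"
  shows "cinner (opnorm_vector A l S x) (opnorm_vector A l T x) =
    complex_of_real l * cinner_wrt A (S x) (T x) +
    (1 - complex_of_real l) * cinner_wrt A x (T x) * cinner_wrt A (S x) x"
proof -
  have s: "complex_of_real (sqrt t) * (complex_of_real (sqrt t) * z) = complex_of_real t * z"
    if "0 \<le> t" for t z
    using that by (simp flip: of_real_mult mult.assoc)
  have "cnj (cinner_wrt A (T x) x) = cinner_wrt A x (T x)"
    by (simp add: cinner_wrt_sqrt_op[OF A] flip: cinner_commute)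
  then show ?thesis
    using l
    by (simp add: s opnorm_vector_def cinner_prod_def cinner_complex_def cinner_scaleR_left
        cinner_scaleR_right mult_ac flip: cinner_wrt_sqrt_op[OF A])
qed

lemma norm_opnorm_vector:
  assumes A: "positive_op A" and l: "0 \<le> l" "l \<le> 1"
  shows "norm (opnorm_vector A l T x) =
    sqrt (l * (norm_wrt A (T x))\<^sup>2 + (1 - l) * (cmod (cinner_wrt A (T x) x))\<^sup>2)"
  using l by (simp add: opnorm_vector_def norm_Pair norm_mult power_mult_distrib
      norm_wrt_sqrt_op[OF A])

lemma bounded_opnorm_vector:
  assumes A: "positive_op A" and l: "0 \<le> l" "l \<le> 1" and T: "T \<in> sqrt_adjointable_ops A"
  shows "bounded (opnorm_vector A l T ` {x. norm_wrt A x = 1})"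
proof -
  obtain r where r: "0 \<le> r" "\<And>x. norm_wrt A (T x) \<le> r * norm_wrt A x"
    using sqrt_adjointable_norm_wrt_le[OF A T] by blast
  have "norm (opnorm_vector A l T x) \<le> r" if x: "norm_wrt A x = 1" for x
  proof -
    have 1: "norm_wrt A (T x) \<le> r" using r(2)[of x] x by simp
    have "cmod (cinner_wrt A (T x) x) \<le> norm_wrt A (T x) * norm_wrt A x"
      unfolding cinner_wrt_sqrt_op[OF A] norm_wrt_sqrt_op[OF A] by (rule cinner_Cauchy_Schwarz)
    with 1 x have 2: "cmod (cinner_wrt A (T x) x) \<le> r" by simp
    have "0 \<le> norm_wrt A (T x)" by (simp add: norm_wrt_sqrt_op[OF A])
    then have "l * (norm_wrt A (T x))\<^sup>2 + (1 - l) * (cmod (cinner_wrt A (T x) x))\<^sup>2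
      \<le> l * r\<^sup>2 + (1 - l) * r\<^sup>2"
      using 1 2 l by (intro add_mono mult_left_mono power_mono) auto
    then show ?thesis
      unfolding norm_opnorm_vector[OF A l] using r(1)
      by (intro real_le_lsqrt) (auto simp: algebra_simps)
  qed
  then show ?thesis by (auto simp: bounded_iff)
qed

theorem theorem2p3:
  fixes A T S :: "'h::chilbert_space \<Rightarrow>\<^sub>L 'h" and l :: real
  assumes "positive_op A" and "A \<noteq> 0"
    and "0 \<le> l" and "l \<le> 1"
    and "T \<in> sqrt_adjointable_ops A" and "S \<in> sqrt_adjointable_ops A"
  shows "opnorm_wrt A l (T + S) = opnorm_wrt A l T + opnorm_wrt A l S \<longleftrightarrow>
    (\<exists>x :: nat \<Rightarrow> 'h. (\<forall>n. norm_wrt A (x n) = 1) \<and>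
      (\<lambda>n. complex_of_real l * cinner_wrt A (S (x n)) (T (x n)) +
            (1 - complex_of_real l) * cinner_wrt A (x n) (T (x n)) * cinner_wrt A (S (x n)) (x n))
        \<longlonglongrightarrow> complex_of_real (opnorm_wrt A l T * opnorm_wrt A l S))"
proof -
  let ?X = "{x. norm_wrt A x = 1}" and ?v = "opnorm_vector A l"
  have "?X \<noteq> {}"
    using ex_norm_wrt_eq_1[OF assms(1,2)] by blast
  moreover have "opnorm_wrt A l U = (SUP x\<in>?X. norm (?v U x))" for U
    unfolding opnorm_wrt_def norm_opnorm_vector[OF assms(1,3,4)] ..
  ultimately show ?thesis
    using sup_norm_add_iff[of ?X "?v T" "?v S"]
      bounded_opnorm_vector[OF assms(1,3,4,5)] bounded_opnorm_vector[OF assms(1,3,4,6)]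
    by (simp add: opnorm_vector_add cinner_opnorm_vector[OF assms(1,3,4)])
qed

end
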